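(* Let $t, k, g$ be integers such that $t, k \geq 2$ and $g \geq \max\{4, k+1\}$, and let $F$ be a connected graph of order $k$ and constant link $L$ and with circumference $c$. Then there is an integer $n$ such that, for any $q \geq 1$, there is a connected graph of constant link $tL$ and order $qn$ without cycles of length $\ell$ for any $c < \ell < g$.
   Context: All graphs are finite and simple; order means number of vertices. A graph $G$ has constant link $L$ if for every vertex $v$ the subgraph induced by the open neighborhood $N(v)$ is isomorphic to $L$; $tL$ is the disjoint union of $t$ copies of $L$. The circumference of a graph is the length of a longest cycle in it. *)

theory Defs
  imports "Graph_Theory.Graph_Theory"
begin

text \<open>
  Finite simple undirected graphs are the library's \<^locale>\<open>pair_graph\<close>: finite, loop-free,
  and with a symmetric set of ordered pairs as arcs.
\<close>

definition neighborhood :: "'a pair_pre_digraph \<Rightarrow> 'a \<Rightarrow> 'a set" where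
  "neighborhood G v = {w. (v, w) \<in> parcs G}"

definition has_constant_link :: "'a pair_pre_digraph \<Rightarrow> 'b pair_pre_digraph \<Rightarrow> bool" where
  "has_constant_link G L \<longleftrightarrow>
     (\<forall>v \<in> pverts G. digraph_iso (with_proj G \<restriction> neighborhood G v) (with_proj L))"

definition copies :: "nat \<Rightarrow> 'a pair_pre_digraph \<Rightarrow> (nat \<times> 'a) pair_pre_digraph" where
  "copies t L =
     \<lparr> pverts = {..<t} \<times> pverts L,
       parcs = {((i, u), (i, v)) | i u v. i < t \<and> (u, v) \<in> parcs L} \<rparr>"

text \<open>
  In a symmetric digraph, traversing an edge back and forth is a directed cycle of length 2;
  the bound 3 leaves exactly the cycles of the undirected graph.
\<close>

definition has_cycle_of_length :: "'a pair_pre_digraph \<Rightarrow> nat \<Rightarrow> bool" where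
  "has_cycle_of_length G l \<longleftrightarrow>
     3 \<le> l \<and> (\<exists>p. pre_digraph.cycle (with_proj G) p \<and> length p = l)"

text \<open>
  An acyclic graph gets circumference 0. Among connected graphs with constant link and at
  least two vertices, this concerns only the complete graph on two vertices.
\<close>

definition circumference :: "'a pair_pre_digraph \<Rightarrow> nat" where
  "circumference G = Max (insert 0 {l. has_cycle_of_length G l})"

lemma has_cycle_of_length_le_card:
  assumes "pair_graph G" "has_cycle_of_length G l"
  shows "l \<le> card (pverts G)"
proof -
  interpret pair_graph G by fact
  obtain p u where p: "length p = l" "awalk u p u" "distinct (tl (pawalk_verts u p))"
    using assms(2) by (auto simp: has_cycle_of_length_def cycle_def)
  have "length (pawalk_verts u p) = Suc (length p)"
    by (induction p arbitrary: u) auto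
  then have "l = card (set (tl (pawalk_verts u p)))"
    using p(1) distinct_card[OF p(3)] by simp
  moreover have "set (pawalk_verts u p) \<subseteq> pverts G"
    using p(2) by auto
  then have "set (tl (pawalk_verts u p)) \<subseteq> pverts G"
    by (cases "pawalk_verts u p") auto
  ultimately show ?thesis
    by (simp add: card_mono pair_finite_verts)
qed

lemma finite_cycle_lengths:
  assumes "pair_graph G"
  shows "finite {l. has_cycle_of_length G l}"
  using has_cycle_of_length_le_card[OF assms]
  by (auto intro: finite_subset[of _ "{..card (pverts G)}"])

end

theory Submission
  imports Defs "HOL-Combinatorics.Permutations"
begin

text \<open>
  Take a finite set of points whose \<open>t\<close>-regular incidence structure with blocks has \<open>k\<close> points
  in each block and no Berge cycle of length less than \<open>g\<close>, and put a copy of \<open>F\<close> on every block. The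
  link of a point is then \<open>t\<close> disjoint copies of \<open>L\<close>, and a cycle of length less than \<open>g\<close> stays within
  one block, so that its length is at most the circumference of \<open>F\<close>.

  To place the copies of \<open>F\<close> canonically, let the points carry types in \<open>V = V(F)\<close> such that each
  block has exactly one point of each type. Such structures are the lifts of the complete bipartite
  graph between \<open>V\<close> and the \<open>t\<close> block indices. Take as voltages on its edges the generators of a
  finite permutation group without short relations, namely the group generated by involutions acting
  on a ball in the Cayley tree of a free product of groups of order 2. A connected component \<open>P\<close> of
  the lift provides \<open>n = card P\<close>. Finally, no edge of the incidence graph of \<open>P\<close> is a bridge, so a
  \<open>q\<close>-fold cyclic cover that is twisted along a single edge is connected; it has order \<open>q n\<close>.
\<close>

section \<open>Block systems\<close>

text \<open>The point \<open>p\<close> of type \<open>\<tau> p\<close> lies on \<open>t\<close> blocks, where block number \<open>i\<close> is the fibre of \<open>b i\<close>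
  through \<open>p\<close>. Fibres of \<open>b i\<close> and \<open>b j\<close> with \<open>i \<noteq> j\<close> are different blocks even if they are equal
  as sets.\<close>

locale block_system =
  fixes t :: nat and V :: "'v set" and P :: "'p set"
    and \<tau> :: "'p \<Rightarrow> 'v" and b :: "nat \<Rightarrow> 'p \<Rightarrow> 'b"
  assumes finite_points: "finite P"
    and type_in: "p \<in> P \<Longrightarrow> \<tau> p \<in> V"
    and ex_in_block: "i < t \<Longrightarrow> p \<in> P \<Longrightarrow> w \<in> V \<Longrightarrow> \<exists>p'\<in>P. b i p' = b i p \<and> \<tau> p' = w"
    and block_type_inj: "i < t \<Longrightarrow> p \<in> P \<Longrightarrow> p' \<in> P \<Longrightarrow> b i p = b i p' \<Longrightarrow> \<tau> p = \<tau> p' \<Longrightarrow> p = p'"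
begin

text \<open>Non-backtracking walks in the incidence graph of points and blocks, recorded by start,
  number of blocks traversed, index of the last block and end. The index attached to a walk of
  length 0 is arbitrary, so that it never restricts the first step.\<close>

inductive reduced_walk :: "'p \<Rightarrow> nat \<Rightarrow> nat \<Rightarrow> 'p \<Rightarrow> bool" where
  start: "p \<in> P \<Longrightarrow> reduced_walk p 0 i p"
| step: "reduced_walk p m i q \<Longrightarrow> j < t \<Longrightarrow> j \<noteq> i \<Longrightarrow> q' \<in> P \<Longrightarrow> b j q = b j q' \<Longrightarrow> q \<noteq> q'
    \<Longrightarrow> reduced_walk p (Suc m) j q'"

lemma reduced_walk_in: "reduced_walk p m i q \<Longrightarrow> p \<in> P \<and> q \<in> P"
  by (induction rule: reduced_walk.induct) auto

text \<open>Nothing is required where the walk closes up: if its first and last block coincide, a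
  shorter closed reduced walk can be cut out. So this is the absence of Berge cycles with fewer than
  \<open>g\<close> blocks.\<close>

definition girth_ge :: "nat \<Rightarrow> bool" where
  "girth_ge g \<longleftrightarrow> (\<forall>p m i. reduced_walk p m i p \<longrightarrow> m < g \<longrightarrow> m = 0)"

definition block_closed :: "'p set \<Rightarrow> bool" where
  "block_closed C \<longleftrightarrow> C \<subseteq> P \<and> (\<forall>p\<in>C. \<forall>p'\<in>P. \<forall>i<t. b i p = b i p' \<longrightarrow> p' \<in> C)"

definition block_connected :: bool where
  "block_connected \<longleftrightarrow> P \<noteq> {} \<and> (\<forall>C. block_closed C \<longrightarrow> C \<noteq> {} \<longrightarrow> C = P)"

text \<open>Merging consecutive edges that lie in the same block turns the cycle into a reduced
  walk. If the cycle ever left its first block, a nonempty closed reduced walk of length at most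
  \<open>l\<close> would result.\<close>

lemma cycle_in_one_block:
  assumes girth: "girth_ge g" and "2 \<le> l" "l < g"
    and inj: "inj_on x {..<l}" and xP: "\<And>j. j < l \<Longrightarrow> x j \<in> P"
    and adj: "\<And>j. Suc j < l \<Longrightarrow> \<exists>i<t. b i (x j) = b i (x (Suc j))"
    and adj_last: "\<exists>i<t. b i (x (l - 1)) = b i (x 0)"
  shows "\<exists>i<t. \<forall>j<l. b i (x j) = b i (x 0)"
proof -
  have neq: "x j \<noteq> x k" if "j < l" "k < l" "j \<noteq> k" for j k
    using inj that by (auto dest: inj_onD)
  \<comment> \<open>The last block is kept pending: \<open>a\<close> is the vertex where the cycle
    entered block \<open>i\<close>, and the step from \<open>a\<close> is taken only once the cycle
    leaves that block. As long as \<open>m = 0\<close>, everything so far lies in block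
    \<open>i\<close>.\<close>
  have inv: "\<exists>m a i i'. reduced_walk (x 0) m i' a \<and> m < Suc j \<and> a \<in> x ` {..j} \<and> i < t \<and> i \<noteq> i'
      \<and> b i a = b i (x (Suc j)) \<and> (m = 0 \<longrightarrow> (\<forall>k\<le>Suc j. b i (x k) = b i (x 0)))"
    if "Suc j < l" for j
    using that
  proof (induction j)
    case 0
    then obtain i where i: "i < t" "b i (x 0) = b i (x 1)" using adj[of 0] by auto
    have "reduced_walk (x 0) 0 (Suc i) (x 0)" using xP 0 by (auto intro: reduced_walk.start)
    then show ?case using i
      by (intro exI[of _ 0] exI[of _ "x 0"] exI[of _ i] exI[of _ "Suc i"]) (auto simp: le_Suc_eq)
  next
    case (Suc j)
    have "Suc j < l" using Suc.prems by simp
    from Suc.IH[OF this]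
    obtain m a i i' where IH: "reduced_walk (x 0) m i' a" "m < Suc j" "a \<in> x ` {..j}" "i < t" "i \<noteq> i'"
      "b i a = b i (x (Suc j))" "m = 0 \<Longrightarrow> (\<forall>k\<le>Suc j. b i (x k) = b i (x 0))" by blast
    obtain e where e: "e < t" "b e (x (Suc j)) = b e (x (Suc (Suc j)))"
      using adj[of "Suc j"] Suc.prems by auto
    show ?case
    proof (cases "e = i")
      case True
      have "\<forall>k\<le>Suc (Suc j). b i (x k) = b i (x 0)" if "m = 0"
        using IH(7)[OF that] e True by (metis le_SucE order_refl)
      moreover have "m < Suc (Suc j)" "a \<in> x ` {..Suc j}" "b i a = b i (x (Suc (Suc j)))"
        using IH(2,3,6) e True by auto
      ultimately show ?thesis using IH(1,4,5) by blast
    next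
      case False
      obtain k where "k \<le> j" "a = x k" using IH(3) by auto
      then have "a \<noteq> x (Suc j)" using neq[of k "Suc j"] Suc.prems by simp
      then have "reduced_walk (x 0) (Suc m) i (x (Suc j))"
        using IH(4-6) xP[of "Suc j"] Suc.prems by (intro reduced_walk.step[OF IH(1)]) simp_all
      then show ?thesis using IH e False
        by (intro exI[of _ "Suc m"] exI[of _ "x (Suc j)"] exI[of _ e] exI[of _ i]) auto
    qed
  qed
  obtain j where j: "l = Suc (Suc j)" using \<open>2 \<le> l\<close> by (metis add_2_eq_Suc le_Suc_ex)
  obtain m a i i' where w: "reduced_walk (x 0) m i' a" "m < Suc j" "a \<in> x ` {..j}" "i < t" "i \<noteq> i'"
      "b i a = b i (x (Suc j))" "m = 0 \<Longrightarrow> (\<forall>k\<le>Suc j. b i (x k) = b i (x 0))"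
    using inv[of j] j by blast
  obtain e where e: "e < t" "b e (x (Suc j)) = b e (x 0)" using adj_last j by auto
  obtain k where "k \<le> j" "a = x k" using w(3) by auto
  then have a: "a \<noteq> x (Suc j)" using neq[of k "Suc j"] j by simp
  have no: "n = 0" if "reduced_walk (x 0) n i (x 0)" "n < g" for n i
    using girth that by (auto simp: girth_ge_def)
  have x0: "x 0 \<in> P" "x (Suc j) \<in> P" "x (Suc j) \<noteq> x 0"
    using xP[of 0] xP[of "Suc j"] neq[of "Suc j" 0] j by simp_all
  show ?thesis
  \<comment> \<open>If the closing edge changes the block, two more steps close the walk. Otherwise
    one step from \<open>a\<close> does, unless \<open>a = x 0\<close>, in which case the walk is
    closed already.\<close>
  proof (cases "e = i")
    case False
    have "reduced_walk (x 0) (Suc m) i (x (Suc j))" using w(4-6) a x0 by (intro reduced_walk.step[OF w(1)]) simp_all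
    then have "reduced_walk (x 0) (Suc (Suc m)) e (x 0)" by (rule reduced_walk.step) (use e x0 False in auto)
    from no[OF this] w(2) j \<open>l < g\<close> show ?thesis by simp
  next
    case True
    show ?thesis
    proof (cases "m = 0")
      case True
      then show ?thesis using w(4) w(7) j by (metis less_Suc_eq_le)
    next
      case False
      then have "a \<noteq> x 0" using no[of m] w(1,2) j \<open>l < g\<close> by force
      then have "reduced_walk (x 0) (Suc m) i (x 0)"
        using w(4-6) e x0 \<open>e = i\<close> by (intro reduced_walk.step[OF w(1)]) simp_all
      from no[OF this] w(2) j \<open>l < g\<close> show ?thesis by simp
    qed
  qed
qed

section \<open>Gluing copies of \<open>F\<close> along the blocks\<close>

definition amalgam :: "'v rel \<Rightarrow> 'p pair_pre_digraph" where
  "amalgam E = \<lparr> pverts = P,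
     parcs = {(p, p'). p \<in> P \<and> p' \<in> P \<and> (\<exists>i<t. b i p = b i p') \<and> (\<tau> p, \<tau> p') \<in> E} \<rparr>"

lemma pverts_amalgam [simp]: "pverts (amalgam E) = P"
  by (simp add: amalgam_def)

lemma parcs_amalgam:
  "(p, p') \<in> parcs (amalgam E) \<longleftrightarrow> p \<in> P \<and> p' \<in> P \<and> (\<exists>i<t. b i p = b i p') \<and> (\<tau> p, \<tau> p') \<in> E"
  by (simp add: amalgam_def)

lemma pair_graph_amalgam:
  assumes "pair_graph F"
  shows "pair_graph (amalgam (parcs F))"
proof -
  interpret F: pair_graph F by fact
  have sub: "parcs (amalgam (parcs F)) \<subseteq> P \<times> P" by (auto simp: amalgam_def)
  show ?thesis
  proof
    show "finite (parcs (amalgam (parcs F)))" using finite_subset[OF sub] finite_points by auto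
    show "symmetric (with_proj (amalgam (parcs F)))"
      unfolding symmetric_def with_proj_simps
      by (rule symI) (auto simp: parcs_amalgam F.arcs_symmetric intro: sym)
  qed (use sub finite_points in \<open>auto simp: parcs_amalgam dest: F.no_loops'\<close>)
qed

text \<open>A walk in \<open>F\<close> lifts to any block from a prescribed first point, and its end
  is determined by its type. Hence the set of points reachable from a given one is
  block-closed.\<close>

lemma connected_amalgam:
  assumes F: "pair_graph F" "pverts F = V" "Digraph_Component.connected (with_proj F)"
    and conn: "block_connected"
  shows "Digraph_Component.connected (with_proj (amalgam (parcs F)))"
proof -
  interpret F: pair_graph F by fact
  interpret G: pair_graph "amalgam (parcs F)" by (rule pair_graph_amalgam) fact
  have sF: "strongly_connected (with_proj F)"
    using F.symmetric_connected_imp_strongly_connected F.pair_sym_arcs F(3) by auto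
  have in_block: "p \<rightarrow>\<^sup>*\<^bsub>with_proj (amalgam (parcs F))\<^esub> p'"
    if p: "p \<in> P" "p' \<in> P" "i < t" "b i p = b i p'" for p p' i
  proof -
    have "\<tau> p \<rightarrow>\<^sup>*\<^bsub>with_proj F\<^esub> \<tau> p'" using sF p type_in F(2) by (auto simp: strongly_connected_def)
    then have "\<exists>q\<in>P. b i q = b i p \<and> \<tau> q = \<tau> p' \<and> p \<rightarrow>\<^sup>*\<^bsub>with_proj (amalgam (parcs F))\<^esub> q"
    proof (induction rule: F.reachable_induct)
      case base
      then show ?case using p by (intro bexI[of _ p]) auto
    next
      case (step v w)
      then obtain q where q: "q \<in> P" "b i q = b i p" "\<tau> q = v"
        "p \<rightarrow>\<^sup>*\<^bsub>with_proj (amalgam (parcs F))\<^esub> q" by auto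
      have vw: "(v, w) \<in> parcs F" using step by simp
      then have "w \<in> V" using F(2) F.in_arcsD2 by blast
      then obtain r where r: "r \<in> P" "b i r = b i q" "\<tau> r = w" using ex_in_block[of i q w] p(3) q(1) by blast
      have "(q, r) \<in> parcs (amalgam (parcs F))" using p q r vw by (auto simp: parcs_amalgam)
      then show ?case using q r by (intro bexI[of _ r]) (auto intro: G.reachable_adj_trans)
    qed
    then show ?thesis using block_type_inj[of i _ p'] p by auto
  qed
  obtain p0 where p0: "p0 \<in> P" using conn by (auto simp: block_connected_def)
  define C where "C = {p. p0 \<rightarrow>\<^sup>*\<^bsub>with_proj (amalgam (parcs F))\<^esub> p}"
  have CP: "C \<subseteq> P" unfolding C_def using G.reachable_in_verts by auto
  have "block_closed C" unfolding block_closed_def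
  proof (intro conjI ballI allI impI)
    fix p p' i assume "p \<in> C" "p' \<in> P" "i < t" "b i p = b i p'"
    then show "p' \<in> C" using in_block[of p p' i] CP G.reachable_trans unfolding C_def by blast
  qed (rule CP)
  moreover have "p0 \<in> C" using p0 by (simp add: C_def)
  ultimately have "C = P" using conn by (auto simp: block_connected_def)
  then have "p \<rightarrow>\<^sup>*\<^bsub>with_proj (amalgam (parcs F))\<^esub> p'" if "p \<in> P" "p' \<in> P" for p p'
    using that G.reachable_trans[OF G.symmetric_reachable'[of p0 p], of p'] by (auto simp: C_def)
  then have "strongly_connected (with_proj (amalgam (parcs F)))"
    using p0 by (intro strongly_connectedI) auto
  then show ?thesis
    using G.reachable_mk_symmetricI by (auto simp: Digraph_Component.connected_def strongly_connected_def)
qed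

end

section \<open>Links and cycles described by vertices alone\<close>

text \<open>Isomorphisms of the library map vertices and arcs separately. Since tail and head are
  \<open>fst\<close> and \<open>snd\<close> on both sides, the vertex map induces the arc
  map.\<close>

lemma digraph_iso_induced_iff:
  assumes "pair_wf_digraph G" "pair_wf_digraph H" "S \<subseteq> pverts G"
  shows "digraph_iso (with_proj G \<restriction> S) (with_proj H) \<longleftrightarrow>
    (\<exists>f. bij_betw f S (pverts H) \<and> (\<forall>x\<in>S. \<forall>y\<in>S. (x, y) \<in> parcs G \<longleftrightarrow> (f x, f y) \<in> parcs H))"
proof
  interpret G: pair_wf_digraph G by fact
  interpret H: pair_wf_digraph H by fact
  {
    assume "digraph_iso (with_proj G \<restriction> S) (with_proj H)"
    then obtain h where h: "pre_digraph.digraph_isomorphism (with_proj G \<restriction> S) h"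
      and H: "with_proj H = app_iso h (with_proj G \<restriction> S)" by (auto simp: digraph_iso_def)
    have verts: "pverts H = iso_verts h ` S" using arg_cong[OF H, of verts] by simp
    have arcs: "parcs H = iso_arcs h ` {e \<in> parcs G. fst e \<in> S \<and> snd e \<in> S}"
      using arg_cong[OF H, of arcs] by (simp add: induce_subgraph_def)
    have tail: "iso_tail h = fst" and head: "iso_head h = snd"
      using arg_cong[OF H, of tail] arg_cong[OF H, of head] by simp_all
    have inj: "inj_on (iso_verts h) S" and
      arc: "\<And>e. e \<in> parcs G \<Longrightarrow> fst e \<in> S \<Longrightarrow> snd e \<in> S \<Longrightarrow>
        iso_arcs h e = (iso_verts h (fst e), iso_verts h (snd e))"
      using h by (auto simp: pre_digraph.digraph_isomorphism_def tail head induce_subgraph_def prod_eq_iff)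
    have "(x, y) \<in> parcs G \<longleftrightarrow> (iso_verts h x, iso_verts h y) \<in> parcs H" if "x \<in> S" "y \<in> S" for x y
    proof
      assume "(x, y) \<in> parcs G"
      then show "(iso_verts h x, iso_verts h y) \<in> parcs H"
        unfolding arcs using arc[of "(x, y)"] that by (intro image_eqI[of _ _ "(x, y)"]) auto
    next
      assume "(iso_verts h x, iso_verts h y) \<in> parcs H"
      then obtain e where e: "e \<in> parcs G" "fst e \<in> S" "snd e \<in> S"
        "(iso_verts h x, iso_verts h y) = iso_arcs h e" unfolding arcs by auto
      then have "fst e = x" "snd e = y" using arc[of e] inj that by (auto dest: inj_onD)
      then show "(x, y) \<in> parcs G" using e by (metis prod.collapse)
    qed
    then show "\<exists>f. bij_betw f S (pverts H) \<and> (\<forall>x\<in>S. \<forall>y\<in>S. (x, y) \<in> parcs G \<longleftrightarrow> (f x, f y) \<in> parcs H)"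
      using verts inj by (intro exI[of _ "iso_verts h"]) (auto simp: bij_betw_def)
  next
    assume "\<exists>f. bij_betw f S (pverts H) \<and> (\<forall>x\<in>S. \<forall>y\<in>S. (x, y) \<in> parcs G \<longleftrightarrow> (f x, f y) \<in> parcs H)"
    then obtain f where f: "bij_betw f S (pverts H)"
      and fe: "\<And>x y. x \<in> S \<Longrightarrow> y \<in> S \<Longrightarrow> (x, y) \<in> parcs G \<longleftrightarrow> (f x, f y) \<in> parcs H" by auto
    define h where "h = \<lparr> iso_verts = f, iso_arcs = map_prod f f, iso_head = snd, iso_tail = fst \<rparr>"
    have inj: "inj_on f S" using f by (simp add: bij_betw_def)
    have "wf_digraph (with_proj G \<restriction> S)" by (rule G.wellformed_induce_subgraph)
    moreover have "inj_on (map_prod f f) {e \<in> parcs G. fst e \<in> S \<and> snd e \<in> S}"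
      using inj by (auto simp: inj_on_def)
    ultimately have "pre_digraph.digraph_isomorphism (with_proj G \<restriction> S) h"
      using inj by (auto simp: pre_digraph.digraph_isomorphism_def h_def induce_subgraph_def)
    moreover have "with_proj H = app_iso h (with_proj G \<restriction> S)"
    proof -
      have "parcs H \<subseteq> map_prod f f ` {e \<in> parcs G. fst e \<in> S \<and> snd e \<in> S}"
      proof
        fix e assume e: "e \<in> parcs H"
        then have "fst e \<in> f ` S" "snd e \<in> f ` S"
          using f H.arc_fst_in_verts H.arc_snd_in_verts by (auto simp: bij_betw_def)
        then obtain x y where "x \<in> S" "y \<in> S" "e = (f x, f y)" by (metis imageE prod.collapse)
        then show "e \<in> map_prod f f ` {e \<in> parcs G. fst e \<in> S \<and> snd e \<in> S}"
          using fe e by (intro image_eqI[of _ _ "(x, y)"]) auto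
      qed
      then have "parcs H = map_prod f f ` {e \<in> parcs G. fst e \<in> S \<and> snd e \<in> S}"
        using fe by auto
      then show ?thesis using f
        by (simp add: with_proj_def app_iso_def h_def induce_subgraph_def bij_betw_def)
    qed
    ultimately show "digraph_iso (with_proj G \<restriction> S) (with_proj H)"
      by (auto simp: digraph_iso_def)
  }
qed


lemma has_constant_link_iff:
  assumes "pair_wf_digraph G" "pair_wf_digraph L"
  shows "has_constant_link G L \<longleftrightarrow> (\<forall>v\<in>pverts G. \<exists>f. bij_betw f (neighborhood G v) (pverts L) \<and>
    (\<forall>x\<in>neighborhood G v. \<forall>y\<in>neighborhood G v. (x, y) \<in> parcs G \<longleftrightarrow> (f x, f y) \<in> parcs L))"
proof -
  interpret G: pair_wf_digraph G by fact
  have "neighborhood G v \<subseteq> pverts G" for v by (auto simp: neighborhood_def dest: G.in_arcsD2)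
  then show ?thesis unfolding has_constant_link_def by (simp add: digraph_iso_induced_iff assms)
qed

lemma pair_wf_digraph_copies:
  assumes "pair_wf_digraph L"
  shows "pair_wf_digraph (copies t L)"
proof -
  interpret L: pair_wf_digraph L by fact
  show ?thesis by unfold_locales (auto simp: copies_def dest: L.in_arcsD1 L.in_arcsD2)
qed

lemma has_cycle_of_length_iff:
  assumes "pair_wf_digraph G"
  shows "has_cycle_of_length G l \<longleftrightarrow> 3 \<le> l \<and> (\<exists>x. inj_on x {..<l} \<and> (x (l - 1), x 0) \<in> parcs G \<and>
    (\<forall>j. Suc j < l \<longrightarrow> (x j, x (Suc j)) \<in> parcs G))"
proof -
  interpret G: pair_wf_digraph G by fact
  have pcas_iff: "pcas u p v \<longleftrightarrow> (if p = [] then u = v else fst (p ! 0) = u \<and> snd (last p) = v \<and>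
    (\<forall>j. Suc j < length p \<longrightarrow> snd (p ! j) = fst (p ! Suc j)))" for u v :: 'a and p
  proof (induction p arbitrary: u)
    case (Cons e p)
    show ?case
    proof (cases p)
      case (Cons e' p')
      then show ?thesis using Cons.IH
        by (auto simp: All_less_Suc2)
    qed auto
  qed auto
  have verts: "tl (pawalk_verts u p) = map snd p" if "pcas u p v" for u v :: 'a and p
    using that
  proof (induction p arbitrary: u)
    case (Cons e p)
    then show ?case by (cases p) auto
  qed auto
  show ?thesis
  proof (intro iffI conjI; (elim conjE)?)
    assume "has_cycle_of_length G l"
    then obtain p u where l: "3 \<le> l" "length p = l" and w: "G.awalk u p u" "distinct (tl (pawalk_verts u p))"
      by (auto simp: has_cycle_of_length_def G.cycle_def)
    then have w': "set p \<subseteq> parcs G" "pcas u p u" by (auto simp: G.awalk_def)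
    have "distinct (map snd p)" using w verts[OF w'(2)] by simp
    \<comment> \<open>Arc number \<open>j\<close> runs from \<open>x (j - 1)\<close> to
      \<open>x j\<close>, cyclically. The heads are the vertices that \<open>cycle\<close> requires
      to be distinct.\<close>
    define x where "x j = snd (p ! j)" for j
    have "inj_on x {..<l}"
      using \<open>distinct (map snd p)\<close> l by (auto simp: x_def inj_on_def distinct_conv_nth)
    moreover have "(x j, x (Suc j)) \<in> parcs G" if "Suc j < l" for j
    proof -
      have "p ! Suc j = (x j, x (Suc j))"
        using w'(2) l that by (auto simp: pcas_iff x_def prod_eq_iff split: if_splits)
      then show ?thesis using w'(1) l that nth_mem[of "Suc j" p] by auto
    qed
    moreover have "(x (l - 1), x 0) \<in> parcs G"
    proof -
      have "p \<noteq> []" using l by auto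
      then have "p ! 0 = (x (l - 1), x 0)"
        using w'(2) l by (simp add: pcas_iff x_def prod_eq_iff last_conv_nth)
      then show ?thesis using w'(1) l nth_mem[of 0 p] by auto
    qed
    ultimately show "\<exists>x. inj_on x {..<l} \<and> (x (l - 1), x 0) \<in> parcs G \<and>
      (\<forall>j. Suc j < l \<longrightarrow> (x j, x (Suc j)) \<in> parcs G)" by blast
    show "3 \<le> l" by fact
  next
    assume l: "3 \<le> l" and "\<exists>x. inj_on x {..<l} \<and> (x (l - 1), x 0) \<in> parcs G \<and>
      (\<forall>j. Suc j < l \<longrightarrow> (x j, x (Suc j)) \<in> parcs G)"
    then obtain x where x: "inj_on x {..<l}" "(x (l - 1), x 0) \<in> parcs G"
      "\<And>j. Suc j < l \<Longrightarrow> (x j, x (Suc j)) \<in> parcs G" by blast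
    define p where "p = map (\<lambda>j. (x (if j = 0 then l - 1 else j - 1), x j)) [0..<l]"
    have len: "length p = l" by (simp add: p_def)
    have p: "p ! j = (x (if j = 0 then l - 1 else j - 1), x j)" if "j < l" for j
      using that by (simp add: p_def)
    have "p \<noteq> []" using len l by auto
    have walk: "pcas (x (l - 1)) p (x (l - 1))"
      using \<open>p \<noteq> []\<close> l by (simp add: pcas_iff last_conv_nth len p)
    have "set p \<subseteq> parcs G"
    proof
      fix e assume "e \<in> set p"
      then obtain j where "j < l" "e = p ! j" using len by (metis in_set_conv_nth)
      then show "e \<in> parcs G" using x(2) x(3)[of "j - 1"] by (cases "j = 0") (auto simp: p)
    qed
    then have "G.awalk (x (l - 1)) p (x (l - 1))"
      using walk x(2) by (auto simp: G.awalk_def dest: G.in_arcsD1)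
    moreover have "map snd p = map x [0..<l]" by (simp add: p_def)
    then have "distinct (tl (pawalk_verts (x (l - 1)) p))"
      unfolding verts[OF walk] using x(1) by (simp add: distinct_map lessThan_atLeast0)
    ultimately have "G.cycle p" using \<open>p \<noteq> []\<close> by (auto simp: G.cycle_def)
    then show "has_cycle_of_length G l" using l len by (auto simp: has_cycle_of_length_def)
  qed
qed

section \<open>Links and short cycles of the amalgam\<close>

context block_system
begin

lemma girth_closed_2:
  assumes "girth_ge g" "4 \<le> g" "p \<in> P" "q \<in> P" "p \<noteq> q" "i < t" "j < t" "b i p = b i q" "b j p = b j q"
  shows "i = j"
proof (rule ccontr)
  assume "i \<noteq> j"
  have "reduced_walk p (Suc 0) i q"
    using assms by (intro reduced_walk.step[OF reduced_walk.start[of p "Suc i"]]) auto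
  then have "reduced_walk p (Suc (Suc 0)) j p"
    by (rule reduced_walk.step) (use assms \<open>i \<noteq> j\<close> in auto)
  then show False using assms(1,2) by (force simp: girth_ge_def)
qed

text \<open>If the block changes at both \<open>q\<close> and \<open>r\<close>, a closed reduced
  walk of length 3 arises, which \<open>4 \<le> g\<close> forbids. If one of these changes is
  missing, \<open>girth_closed_2\<close> identifies the remaining index.\<close>

lemma girth_closed_3:
  assumes g: "girth_ge g" "4 \<le> g" and P: "p \<in> P" "q \<in> P" "r \<in> P" "p \<noteq> q" "q \<noteq> r" "r \<noteq> p"
    and t: "i < t" "j < t" "k < t" and b: "b i p = b i q" "b j q = b j r" "b k r = b k p"
  shows "i = j \<and> j = k"
proof -
  have eqs: "j = k" if "i = j"
    using girth_closed_2[OF g, of p r i k] P t b that by metis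
  have eqs': "i = j" if "j = k"
    using girth_closed_2[OF g, of p q i j] P t b that by metis
  have "i = j \<or> j = k"
  proof (rule ccontr)
    assume neq: "\<not> (i = j \<or> j = k)"
    have "reduced_walk p (Suc 0) i q"
      using P t b by (intro reduced_walk.step[OF reduced_walk.start[of p "Suc i"]]) auto
    then have "reduced_walk p (Suc (Suc 0)) j r"
      by (rule reduced_walk.step) (use P t b neq in auto)
    then have "reduced_walk p (Suc (Suc (Suc 0))) k p"
      by (rule reduced_walk.step) (use P t b neq in auto)
    then show False using g by (force simp: girth_ge_def)
  qed
  then show ?thesis using eqs eqs' by blast
qed

text \<open>By \<open>girth_closed_2\<close>, a neighbour shares exactly one block with
  \<open>p\<close>, and the index of this block selects the copy of \<open>L\<close>. Adjacent
  neighbours form a triangle with \<open>p\<close>, so \<open>girth_closed_3\<close> rules out edges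
  between different copies.\<close>

lemma has_constant_link_amalgam:
  assumes F: "pair_graph F" "pverts F = V" and L: "pair_graph L" and link: "has_constant_link F L"
    and g: "girth_ge g" "4 \<le> g"
  shows "has_constant_link (amalgam (parcs F)) (copies t L)"
proof -
  interpret F: pair_graph F by fact
  interpret L: pair_graph L by fact
  interpret G: pair_graph "amalgam (parcs F)" by (rule pair_graph_amalgam) fact
  have "\<exists>h. bij_betw h (neighborhood (amalgam (parcs F)) p) (pverts (copies t L)) \<and>
    (\<forall>x\<in>neighborhood (amalgam (parcs F)) p. \<forall>y\<in>neighborhood (amalgam (parcs F)) p.
       (x, y) \<in> parcs (amalgam (parcs F)) \<longleftrightarrow> (h x, h y) \<in> parcs (copies t L))" if p: "p \<in> P" for p
  proof -
    let ?N = "neighborhood (amalgam (parcs F)) p"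
    obtain f where f: "bij_betw f (neighborhood F (\<tau> p)) (pverts L)"
      and fe: "\<And>x y. x \<in> neighborhood F (\<tau> p) \<Longrightarrow> y \<in> neighborhood F (\<tau> p) \<Longrightarrow>
        (x, y) \<in> parcs F \<longleftrightarrow> (f x, f y) \<in> parcs L"
      using link type_in[OF p] F(2) has_constant_link_iff[OF F.pair_wf_digraph L.pair_wf_digraph]
      by auto
    have N: "x \<in> ?N \<longleftrightarrow> x \<in> P \<and> (\<exists>i<t. b i p = b i x) \<and> \<tau> x \<in> neighborhood F (\<tau> p)" for x
      using p by (auto simp: neighborhood_def parcs_amalgam)
    define c where "c x = (SOME i. i < t \<and> b i p = b i x)" for x
    have c: "c x < t" "b (c x) p = b (c x) x" if "x \<in> ?N" for x
      using that someI_ex[of "\<lambda>i. i < t \<and> b i p = b i x"] by (auto simp: N c_def)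
    have ne: "x \<noteq> p" if "x \<in> ?N" for x
      using that F.no_loops'[of "\<tau> p" "\<tau> x"] N[of x] by (auto simp: neighborhood_def[of F])
    have c_eq: "c x = i" if "x \<in> ?N" "i < t" "b i p = b i x" for x i
      using girth_closed_2[OF g p, of x "c x" i] that c[OF that(1)] ne[OF that(1)] by (auto simp: N)
    define h where "h x = (c x, f (\<tau> x))" for x
    have inj_f: "inj_on f (neighborhood F (\<tau> p))" and f_img: "f ` neighborhood F (\<tau> p) = pverts L"
      using f by (auto simp: bij_betw_def)
    have "inj_on h ?N"
    proof (rule inj_onI)
      fix x y assume xy: "x \<in> ?N" "y \<in> ?N" "h x = h y"
      then have "\<tau> x = \<tau> y" using inj_f by (auto simp: h_def N dest: inj_onD)
      then show "x = y" using xy c[OF xy(1)] c[OF xy(2)] block_type_inj[of "c x" x y]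
        by (auto simp: h_def N)
    qed
    moreover have "h ` ?N = pverts (copies t L)"
    proof (intro equalityI subsetI)
      fix z assume "z \<in> h ` ?N"
      then show "z \<in> pverts (copies t L)" using c(1) f_img by (auto simp: copies_def h_def N)
    next
      fix z assume "z \<in> pverts (copies t L)"
      then obtain i u where z: "z = (i, u)" "i < t" "u \<in> pverts L" by (auto simp: copies_def)
      then obtain v where v: "v \<in> neighborhood F (\<tau> p)" "u = f v" using f_img by auto
      then have "v \<in> V" using F(2) F.in_arcsD2 by (auto simp: neighborhood_def)
      then obtain x where x: "x \<in> P" "b i x = b i p" "\<tau> x = v" using ex_in_block z p by blast
      then have "x \<in> ?N" using z v by (auto simp: N intro!: exI[of _ i])
      moreover have "h x = z" using c_eq[OF \<open>x \<in> ?N\<close>, of i] z x v by (simp add: h_def)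
      ultimately show "z \<in> h ` ?N" by blast
    qed
    moreover have "(x, y) \<in> parcs (amalgam (parcs F)) \<longleftrightarrow> (h x, h y) \<in> parcs (copies t L)"
      if x: "x \<in> ?N" and y: "y \<in> ?N" for x y
    proof
      assume "(x, y) \<in> parcs (amalgam (parcs F))"
      then obtain j where j: "j < t" "b j x = b j y" "(\<tau> x, \<tau> y) \<in> parcs F" "x \<in> P" "y \<in> P"
        by (auto simp: parcs_amalgam)
      then have "x \<noteq> y" using F.no_loops' by auto
      have "c x = j \<and> j = c y"
        using girth_closed_3[OF g p j(4,5), of "c x" j "c y"] c[OF x] c[OF y] ne[OF x] ne[OF y] j \<open>x \<noteq> y\<close>
        by auto
      moreover have "(f (\<tau> x), f (\<tau> y)) \<in> parcs L" using fe j x y by (auto simp: N)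
      ultimately show "(h x, h y) \<in> parcs (copies t L)" using j by (auto simp: copies_def h_def)
    next
      assume "(h x, h y) \<in> parcs (copies t L)"
      then have "c x = c y" "(f (\<tau> x), f (\<tau> y)) \<in> parcs L" by (auto simp: copies_def h_def)
      moreover from this have "(\<tau> x, \<tau> y) \<in> parcs F" using fe x y by (auto simp: N)
      ultimately show "(x, y) \<in> parcs (amalgam (parcs F))"
        using c[OF x] c[OF y] x y by (auto simp: parcs_amalgam N intro!: exI[of _ "c y"])
    qed
    ultimately show ?thesis by (intro exI[of _ h]) (auto simp: bij_betw_def)
  qed
  then show ?thesis
    by (simp add: has_constant_link_iff[OF G.pair_wf_digraph pair_wf_digraph_copies[OF L.pair_wf_digraph]])
qed

text \<open>A short cycle stays in one block, where \<open>\<tau>\<close> is injective, so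
  \<open>\<tau>\<close> maps it to a cycle of \<open>F\<close>.\<close>

lemma amalgam_cycle_length:
  assumes F: "pair_graph F" "pverts F = V" and "girth_ge g" "l < g"
    and cyc: "has_cycle_of_length (amalgam (parcs F)) l"
  shows "has_cycle_of_length F l"
proof -
  interpret F: pair_graph F by fact
  interpret G: pair_graph "amalgam (parcs F)" by (rule pair_graph_amalgam) fact
  obtain x where l: "3 \<le> l" and x: "inj_on x {..<l}" "(x (l - 1), x 0) \<in> parcs (amalgam (parcs F))"
      "\<And>j. Suc j < l \<Longrightarrow> (x j, x (Suc j)) \<in> parcs (amalgam (parcs F))"
    using cyc by (auto simp: has_cycle_of_length_iff[OF G.pair_wf_digraph])
  have xP: "x j \<in> P" if "j < l" for j
    using x(2) x(3)[of "j - 1"] that by (cases j) (auto simp: parcs_amalgam)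
  have "\<exists>i<t. \<forall>j<l. b i (x j) = b i (x 0)"
    using assms l x xP by (intro cycle_in_one_block[of g l x]) (auto simp: parcs_amalgam)
  then obtain i where i: "i < t" "\<And>j. j < l \<Longrightarrow> b i (x j) = b i (x 0)" by blast
  have "inj_on (\<tau> \<circ> x) {..<l}"
  proof (rule inj_onI)
    fix j k assume jk: "j \<in> {..<l}" "k \<in> {..<l}" "(\<tau> \<circ> x) j = (\<tau> \<circ> x) k"
    then have "x j = x k"
      using i(1) i(2)[of j] i(2)[of k] xP by (intro block_type_inj[of i "x j" "x k"]) simp_all
    then show "j = k" using x(1) jk by (auto dest: inj_onD)
  qed
  then show ?thesis using x(2,3) l
    by (auto simp: has_cycle_of_length_iff[OF F.pair_wf_digraph] parcs_amalgam intro!: exI[of _ "\<tau> \<circ> x"])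
qed

end

section \<open>Subsystems and cyclic covers\<close>

context block_system
begin

lemma block_system_subset:
  assumes "block_closed C"
  shows "block_system t V C \<tau> b"
proof
  have C: "C \<subseteq> P" using assms by (simp add: block_closed_def)
  then show "finite C" using finite_points finite_subset by blast
  show "\<tau> p \<in> V" if "p \<in> C" for p using C that type_in by blast
  show "\<exists>p'\<in>C. b i p' = b i p \<and> \<tau> p' = w" if ip: "i < t" "p \<in> C" "w \<in> V" for i p w
  proof -
    obtain p' where "p' \<in> P" "b i p' = b i p" "\<tau> p' = w"
      using ex_in_block[OF ip(1) _ ip(3), of p] ip(2) C by blast
    moreover from this have "p' \<in> C" using assms ip unfolding block_closed_def by metis
    ultimately show ?thesis by blast
  qed
  show "p = p'" if "i < t" "p \<in> C" "p' \<in> C" "b i p = b i p'" "\<tau> p = \<tau> p'" for i p p'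
    using that C by (intro block_type_inj[of i p p']) auto
qed

end

section \<open>Maps between block systems, connected subsystems\<close>

text \<open>Block indices are preserved, so consecutive blocks remain different; injectivity on each
  block keeps consecutive points different.\<close>

lemma reduced_walk_image:
  assumes PQ: "f ` P \<subseteq> Q"
    and b: "\<And>i p p'. i < t \<Longrightarrow> p \<in> P \<Longrightarrow> p' \<in> P \<Longrightarrow> b i p = b i p' \<Longrightarrow> b' i (f p) = b' i (f p')"
    and inj: "\<And>i p p'. i < t \<Longrightarrow> p \<in> P \<Longrightarrow> p' \<in> P \<Longrightarrow> b i p = b i p' \<Longrightarrow> f p = f p' \<Longrightarrow> p = p'"
    and w: "block_system.reduced_walk t P b p m i q"
    and "block_system t V P \<tau> b" "block_system t V' Q \<tau>' b'"
  shows "block_system.reduced_walk t Q b' (f p) m i (f q)"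
proof -
  interpret P: block_system t V P \<tau> b by fact
  interpret Q: block_system t V' Q \<tau>' b' by fact
  show ?thesis using w
  proof (induction rule: P.reduced_walk.induct)
    case (start p i)
    then show ?case using PQ by (auto intro: Q.reduced_walk.start)
  next
    case (step p m i q j q')
    have "q \<in> P" using P.reduced_walk_in step(1) by blast
    then show ?case using step PQ b[of j q q'] inj[of j q q']
      by (intro Q.reduced_walk.step[OF step.IH]) auto
  qed
qed

lemma girth_ge_image:
  assumes "f ` P \<subseteq> Q"
    and "\<And>i p p'. i < t \<Longrightarrow> p \<in> P \<Longrightarrow> p' \<in> P \<Longrightarrow> b i p = b i p' \<Longrightarrow> b' i (f p) = b' i (f p')"
    and "\<And>i p p'. i < t \<Longrightarrow> p \<in> P \<Longrightarrow> p' \<in> P \<Longrightarrow> b i p = b i p' \<Longrightarrow> f p = f p' \<Longrightarrow> p = p'"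
    and sys: "block_system t V P \<tau> b" "block_system t V' Q \<tau>' b'"
    and girth: "block_system.girth_ge t Q b' g"
  shows "block_system.girth_ge t P b g"
  unfolding block_system.girth_ge_def[OF sys(1)]
proof (intro allI impI)
  fix p m i assume "block_system.reduced_walk t P b p m i p" "m < g"
  moreover have "block_system.reduced_walk t Q b' (f p) m i (f p)"
    by (rule reduced_walk_image[OF assms(1) _ _ calculation(1) sys]) (fact assms)+
  ultimately show "m = 0"
    using girth unfolding block_system.girth_ge_def[OF sys(2)] by blast
qed

context block_system
begin

text \<open>A nonempty block-closed set of least cardinality is connected, since a set that is
  block-closed within it is block-closed in \<open>P\<close> too.\<close>

lemma ex_connected_subsystem:
  assumes "P \<noteq> {}" "girth_ge g"
  shows "\<exists>C. C \<noteq> {} \<and> block_system t V C \<tau> b \<and> block_system.girth_ge t C b g \<and>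
    block_system.block_connected t C b"
proof -
  have P: "block_closed P" by (auto simp: block_closed_def)
  obtain C where C: "block_closed C" "C \<noteq> {}"
    and min: "\<And>D. block_closed D \<Longrightarrow> D \<noteq> {} \<Longrightarrow> card C \<le> card D"
    using ex_has_least_nat[of "\<lambda>D. block_closed D \<and> D \<noteq> {}" P card] P assms(1) by blast
  have CP: "C \<subseteq> P" using C by (simp add: block_closed_def)
  interpret C: block_system t V C \<tau> b by (rule block_system_subset) fact
  have "C.girth_ge g"
    using CP assms(2) by (intro girth_ge_image[OF _ _ _ C.block_system_axioms block_system_axioms, of "\<lambda>x. x"]) auto
  moreover have "C.block_connected" unfolding C.block_connected_def
  proof (intro conjI allI impI C(2))
    fix D assume D: "C.block_closed D" "D \<noteq> {}"
    then have "D \<subseteq> C" by (simp add: C.block_closed_def)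
    moreover have "block_closed D"
      using D(1) C(1) unfolding C.block_closed_def block_closed_def by blast
    ultimately show "D = C" using min[of D] D(2) by (simp add: C.finite_points card_seteq)
  qed
  ultimately show ?thesis using C(2) C.block_system_axioms by blast
qed

section \<open>Absence of bridges in the incidence graph\<close>

definition partner :: "nat \<Rightarrow> 'v \<Rightarrow> 'p \<Rightarrow> 'p" where
  "partner i w p = (SOME p'. p' \<in> P \<and> b i p' = b i p \<and> \<tau> p' = w)"

lemma partner:
  assumes "i < t" "p \<in> P" "w \<in> V"
  shows "partner i w p \<in> P" "b i (partner i w p) = b i p" "\<tau> (partner i w p) = w"
  using someI_ex[of "\<lambda>p'. p' \<in> P \<and> b i p' = b i p \<and> \<tau> p' = w"] ex_in_block[OF assms]
  unfolding partner_def by blast+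

lemma partner_inj:
  assumes "i < t" "p \<in> P" "p' \<in> P" "w \<in> V" "\<tau> p = \<tau> p'" "partner i w p = partner i w p'"
  shows "p = p'"
  using partner(2)[OF assms(1,2,4)] partner(2)[OF assms(1,3,4)] assms by (intro block_type_inj[of i]) auto

text \<open>Deleting one incidence does not disconnect the incidence graph. Otherwise there is a set
  \<open>D\<close> of points that misses \<open>p0\<close> but contains the rest of the block, and is a union of blocks
  apart from that. The blocks with index 1 show that \<open>D\<close> contains at least as many points of
  type \<open>\<tau> p0\<close> as of type \<open>w\<close>, while the blocks with index 0 show that it contains fewer.\<close>

lemma no_bridge_missing_point:
  assumes t: "2 \<le> t" and p0: "p0 \<in> P" and w: "w \<in> V" "w \<noteq> \<tau> p0"
    and D: "D \<subseteq> P" "p0 \<notin> D" "partner 0 w p0 \<in> D"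
    and closed: "\<And>i p p'. i < t \<Longrightarrow> p \<in> D \<Longrightarrow> p' \<in> P \<Longrightarrow> b i p = b i p' \<Longrightarrow> p' \<in> D \<or> (i = 0 \<and> p' = p0)"
  shows False
proof -
  define v where "v = \<tau> p0"
  have v: "v \<in> V" using p0 type_in by (simp add: v_def)
  have t01: "0 < t" "1 < t" using t by auto
  let ?Dv = "{p\<in>D. \<tau> p = v}" and ?Dw = "{p\<in>D. \<tau> p = w}"
  have fin: "finite D" using D finite_points finite_subset by blast
  have "card ?Dw \<le> card ?Dv"
  proof (rule card_inj_on_le)
    show "inj_on (partner 1 v) ?Dw"
    proof (rule inj_onI)
      fix x y assume "x \<in> ?Dw" "y \<in> ?Dw" "partner 1 v x = partner 1 v y"
      then show "x = y" using D(1) v t01 by (intro partner_inj[of 1 x y v]) auto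
    qed
    show "partner 1 v ` ?Dw \<subseteq> ?Dv"
    proof clarify
      fix p assume p: "p \<in> D" "w = \<tau> p"
      then show "partner 1 v p \<in> D \<and> \<tau> (partner 1 v p) = v"
        using closed[of 1 p "partner 1 v p"] partner[of 1 p v] D t01 v by auto
    qed
  qed (use fin in auto)
  moreover have "card ?Dv \<le> card (?Dw - {partner 0 w p0})"
  proof (rule card_inj_on_le)
    show "inj_on (partner 0 w) ?Dv"
    proof (rule inj_onI)
      fix x y assume "x \<in> ?Dv" "y \<in> ?Dv" "partner 0 w x = partner 0 w y"
      then show "x = y" using D(1) w t01 by (intro partner_inj[of 0 x y w]) auto
    qed
    show "partner 0 w ` ?Dv \<subseteq> ?Dw - {partner 0 w p0}"
    proof clarify
      fix p assume p: "p \<in> D" "v = \<tau> p"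
      then have "partner 0 w p \<noteq> partner 0 w p0"
        using partner_inj[of 0 p p0 w] D t01 w p0 by (auto simp: v_def)
      moreover have "partner 0 w p \<in> P" "b 0 (partner 0 w p) = b 0 p" "\<tau> (partner 0 w p) = w"
        using partner[of 0 p w] p D(1) t01 w by auto
      moreover from this have "partner 0 w p \<in> D"
        using closed[of 0 p "partner 0 w p"] p t01 w by auto
      ultimately show "partner 0 w p \<in> ?Dw - {partner 0 w p0}" by simp
    qed
  qed (use fin in auto)
  moreover have "card (?Dw - {partner 0 w p0}) < card ?Dw"
    using fin D(3) partner(3)[of 0 p0 w] p0 t01 w by (intro card_Diff1_less) auto
  ultimately show False by linarith
qed

text \<open>Unless \<open>D\<close> is block-closed, it separates \<open>p0\<close> from the other
  points of its block of index 0. Then either \<open>D\<close> or \<open>P - D\<close> misses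
  \<open>p0\<close> and contradicts \<open>no_bridge_missing_point\<close>; the closure condition is
  symmetric in the two sets.\<close>

lemma no_bridge:
  assumes conn: "block_connected" and t: "2 \<le> t" and p0: "p0 \<in> P" and w: "w \<in> V" "w \<noteq> \<tau> p0"
    and D: "D \<subseteq> P" "D \<noteq> {}"
    and closed: "\<And>i p p'. i < t \<Longrightarrow> p \<in> D \<Longrightarrow> p' \<in> P \<Longrightarrow> b i p = b i p' \<Longrightarrow>
      (i = 0 \<Longrightarrow> p \<noteq> p0 \<and> p' \<noteq> p0) \<Longrightarrow> p' \<in> D"
  shows "D = P"
proof -
  define a where "a = partner 0 w p0"
  have t0: "0 < t" using t by auto
  have a: "a \<in> P" "b 0 a = b 0 p0" "\<tau> a = w" using partner[OF t0 p0 w(1)] by (auto simp: a_def)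
  have "a \<noteq> p0" using a w by auto
  have iff: "p0 \<in> D \<longleftrightarrow> a \<in> D"
  proof (rule ccontr)
    assume neq: "\<not> (p0 \<in> D \<longleftrightarrow> a \<in> D)"
    show False
    proof (cases "p0 \<in> D")
      case False
      then have "a \<in> D" using neq by auto
      show False
        by (rule no_bridge_missing_point[OF t p0 w D(1) False]) (use \<open>a \<in> D\<close> closed False in \<open>auto simp: a_def[symmetric]\<close>)
    next
      case True
      then have "a \<notin> D" using neq by auto
      show False
      proof (rule no_bridge_missing_point[OF t p0 w, of "P - D"])
        show "p' \<in> P - D \<or> i = 0 \<and> p' = p0" if "i < t" "p \<in> P - D" "p' \<in> P" "b i p = b i p'" for i p p'
          using closed[of i p' p] that True by auto
      qed (use True \<open>a \<notin> D\<close> a in \<open>auto simp: a_def[symmetric]\<close>)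
    qed
  qed
  have "p' \<in> D" if p: "p \<in> D" "p' \<in> P" "i < t" "b i p = b i p'" for p p' i
  proof (cases "i = 0 \<and> (p = p0 \<or> p' = p0)")
    case False
    then show ?thesis using closed[of i p p'] p by auto
  next
    case True
    have "x \<in> D \<longleftrightarrow> p0 \<in> D" if x: "x \<in> P" "b 0 x = b 0 p0" for x
    proof (cases "x = p0")
      case False
      then have "x \<in> D \<longleftrightarrow> a \<in> D"
        using closed[of 0 x a] closed[of 0 a x] x a \<open>a \<noteq> p0\<close> t0 by auto
      then show ?thesis using iff by simp
    qed simp
    then show ?thesis using True p D by auto
  qed
  then have "block_closed D" using D by (auto simp: block_closed_def)
  then show ?thesis using conn D by (auto simp: block_connected_def)
qed

section \<open>Twisted cyclic covers\<close>

text \<open>The second component is the sheet of the cover. Only the incidence of \<open>p0\<close>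
  with its block of index 0 carries voltage 1; all others carry 0.\<close>

definition twist :: "'p \<Rightarrow> nat \<Rightarrow> nat \<Rightarrow> 'p \<times> nat \<Rightarrow> 'b \<times> nat" where
  "twist p0 q i = (\<lambda>(p, j). (b i p, if i = 0 \<and> p = p0 then Suc j mod q else j))"

lemma block_system_twist:
  assumes "1 \<le> q"
  shows "block_system t V (P \<times> {..<q}) (\<tau> \<circ> fst) (twist p0 q)"
proof -
  have mod_inj: "j = k" if "j < q" "k < q" "Suc j mod q = Suc k mod q" for j k
    using that by (auto simp: mod_Suc split: if_splits)
  have mod_surj: "\<exists>j<q. Suc j mod q = k" if "k < q" for k
    using that by (intro exI[of _ "(k + q - 1) mod q"]) (auto simp: mod_Suc_eq)
  show ?thesis
  proof
    show "\<exists>x'\<in>P \<times> {..<q}. twist p0 q i x' = twist p0 q i x \<and> (\<tau> \<circ> fst) x' = w"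
      if ix: "i < t" "x \<in> P \<times> {..<q}" "w \<in> V" for i x w
    proof -
      obtain p j where x: "x = (p, j)" "p \<in> P" "j < q" using ix by auto
      obtain p' where p': "p' \<in> P" "b i p' = b i p" "\<tau> p' = w"
        using ex_in_block[OF ix(1) x(2) ix(3)] by blast
      define k where "k = (if i = 0 \<and> p = p0 then Suc j mod q else j)"
      have "k < q" using x assms by (auto simp: k_def)
      then obtain j' where "j' < q" "(if i = 0 \<and> p' = p0 then Suc j' mod q else j') = k"
        using mod_surj by (cases "i = 0 \<and> p' = p0") auto
      then show ?thesis using p' by (intro bexI[of _ "(p', j')"]) (auto simp: x twist_def k_def)
    qed
    show "x = x'" if "i < t" "x \<in> P \<times> {..<q}" "x' \<in> P \<times> {..<q}"
      "twist p0 q i x = twist p0 q i x'" "(\<tau> \<circ> fst) x = (\<tau> \<circ> fst) x'" for i x x'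
    proof -
      obtain p j p' j' where x: "x = (p, j)" "x' = (p', j')" by (cases x, cases x') auto
      have "p = p'" using that by (intro block_type_inj[of i]) (auto simp: x twist_def)
      then show ?thesis using that mod_inj[of j j'] by (auto simp: x twist_def split: if_splits)
    qed
  qed (auto simp: finite_points type_in)
qed

text \<open>The projection \<open>fst\<close> of the cover onto \<open>P\<close> is injective on
  blocks.\<close>

lemma girth_ge_twist:
  assumes "1 \<le> q" "girth_ge g"
  shows "block_system.girth_ge t (P \<times> {..<q}) (twist p0 q) g"
proof (rule girth_ge_image[OF _ _ _ block_system_twist[OF assms(1)] block_system_axioms assms(2), of fst])
  fix i x x' assume x: "i < t" "x \<in> P \<times> {..<q}" "x' \<in> P \<times> {..<q}"
      "twist p0 q i x = twist p0 q i x'"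
  then show "b i (fst x) = b i (fst x')" by (auto simp: twist_def split: prod.splits)
  assume "fst x = fst x'"
  then show "x = x'" using block_system.block_type_inj[OF block_system_twist[OF assms(1)], of i x x'] x by simp
qed auto

lemma block_connected_twist:
  assumes q: "1 \<le> q" and conn: "block_connected" and t: "2 \<le> t"
    and p0: "p0 \<in> P" and w: "w \<in> V" "w \<noteq> \<tau> p0"
  shows "block_system.block_connected t (P \<times> {..<q}) (twist p0 q)"
proof -
  interpret Q: block_system t V "P \<times> {..<q}" "\<tau> \<circ> fst" "twist p0 q" by (rule block_system_twist) fact
  have "C = P \<times> {..<q}" if C: "Q.block_closed C" "C \<noteq> {}" for C
  proof -
    have CP: "C \<subseteq> P \<times> {..<q}" using C by (simp add: Q.block_closed_def)
    have closed: "x' \<in> C" if "x \<in> C" "x' \<in> P \<times> {..<q}" "i < t" "twist p0 q i x = twist p0 q i x'" for x x' i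
      using C(1) that unfolding Q.block_closed_def by blast
    \<comment> \<open>Away from the twisted incidence a sheet looks like \<open>P\<close>, which
      stays connected without that incidence by \<open>no_bridge\<close>.\<close>
    have full: "(p', j) \<in> C" if pj: "(p, j) \<in> C" "p' \<in> P" for p p' j
    proof -
      have "{p. (p, j) \<in> C} = P"
      proof (rule no_bridge[OF conn t p0 w])
        show "{p. (p, j) \<in> C} \<subseteq> P" using CP by auto
        show "{p. (p, j) \<in> C} \<noteq> {}" using pj by auto
        fix i x x' assume "i < t" "x \<in> {p. (p, j) \<in> C}" "x' \<in> P" "b i x = b i x'"
          "i = 0 \<Longrightarrow> x \<noteq> p0 \<and> x' \<noteq> p0"
        moreover have "j < q" using pj CP by auto
        moreover from calculation have "twist p0 q i (x, j) = twist p0 q i (x', j)"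
          by (auto simp: twist_def)
        ultimately show "x' \<in> {p. (p, j) \<in> C}"
          using closed[of "(x, j)" "(x', j)" i] by auto
      qed
      then show ?thesis using pj by blast
    qed
    \<comment> \<open>The block of index 0 through \<open>(p0, j)\<close> has its other points on
      the next sheet, and \<open>?a\<close> is such a point.\<close>
    have next_level: "(p0, Suc j mod q) \<in> C" if j: "(p0, j) \<in> C" for j
    proof -
      have t0: "0 < t" using t by simp
      let ?a = "partner 0 w p0"
      have a: "?a \<in> P" "b 0 ?a = b 0 p0" "?a \<noteq> p0" using partner[OF t0 p0 w(1)] w by auto
      have "(?a, Suc j mod q) \<in> C" using a j q t0
        by (intro closed[OF j, of _ 0]) (auto simp: twist_def)
      then show ?thesis using full p0 by blast
    qed
    obtain p j where "(p, j) \<in> C" using C(2) by auto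
    then have j: "(p0, j) \<in> C" "j < q" using full p0 CP by auto
    have "(p0, (j + k) mod q) \<in> C" for k
    proof (induction k)
      case 0
      then show ?case using j by simp
    next
      case (Suc k)
      then show ?case using next_level[OF Suc] by (simp add: mod_Suc_eq)
    qed
    note levels = this
    have "(p0, k) \<in> C" if "k < q" for k
    proof -
      have "(j + (q - j + k)) mod q = k" using j that by simp
      then show ?thesis using levels[of "q - j + k"] by simp
    qed
    then have "P \<times> {..<q} \<subseteq> C" using full by blast
    then show ?thesis using CP by blast
  qed
  moreover have "P \<times> {..<q} \<noteq> {}" using p0 q by (auto simp: lessThan_empty_iff)
  ultimately show ?thesis by (auto simp: Q.block_connected_def)
qed

end

text \<open>This allows natural numbers as the vertices of the final graph.\<close>

lemma transport_block_system:
  assumes f: "bij_betw f Q P" and "block_system t V P \<tau> b"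
    and girth: "block_system.girth_ge t P b g" and conn: "block_system.block_connected t P b"
  shows "block_system t V Q (\<tau> \<circ> f) (\<lambda>i. b i \<circ> f) \<and> block_system.girth_ge t Q (\<lambda>i. b i \<circ> f) g \<and>
    block_system.block_connected t Q (\<lambda>i. b i \<circ> f)"
proof -
  interpret P: block_system t V P \<tau> b by fact
  have inj: "inj_on f Q" and img: "f ` Q = P" using f by (auto simp: bij_betw_def)
  interpret Q: block_system t V Q "\<tau> \<circ> f" "\<lambda>i. b i \<circ> f"
  proof
    show "finite Q" using bij_betw_finite[OF f] P.finite_points by simp
    show "(\<tau> \<circ> f) p \<in> V" if "p \<in> Q" for p using that img P.type_in by auto
    show "\<exists>p'\<in>Q. (b i \<circ> f) p' = (b i \<circ> f) p \<and> (\<tau> \<circ> f) p' = w" if "i < t" "p \<in> Q" "w \<in> V" for i p w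
      using P.ex_in_block[of i "f p" w] that img by auto
    show "p = p'" if "i < t" "p \<in> Q" "p' \<in> Q" "(b i \<circ> f) p = (b i \<circ> f) p'" "(\<tau> \<circ> f) p = (\<tau> \<circ> f) p'" for i p p'
      using P.block_type_inj[of i "f p" "f p'"] that img inj by (auto dest: inj_onD)
  qed
  have "Q.girth_ge g"
    using img inj girth
    by (intro girth_ge_image[OF _ _ _ Q.block_system_axioms P.block_system_axioms, of f]) (auto dest: inj_onD)
  moreover have "Q.block_connected" unfolding Q.block_connected_def
  proof (intro conjI allI impI)
    show "Q \<noteq> {}" using conn img by (auto simp: P.block_connected_def)
    fix C assume C: "Q.block_closed C" "C \<noteq> {}"
    then have CQ: "C \<subseteq> Q" by (simp add: Q.block_closed_def)
    have "P.block_closed (f ` C)"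
      unfolding P.block_closed_def
    proof (intro conjI ballI allI impI)
      fix p p' i assume "p \<in> f ` C" "p' \<in> P" "i < t" "b i p = b i p'"
      then show "p' \<in> f ` C" using C(1) img unfolding Q.block_closed_def by force
    qed (use CQ img in auto)
    then have "f ` C = P" using conn C(2) by (auto simp: P.block_connected_def)
    then show "C = Q" using CQ inj img by (metis inj_on_image_eq_iff order_refl)
  qed
  ultimately show ?thesis using Q.block_system_axioms by blast
qed

section \<open>Block systems of large girth\<close>

text \<open>Normal forms in the free product: all generators are involutions, so a word is reduced
  iff no two adjacent letters agree.\<close>

definition reduced_words :: "'s set \<Rightarrow> nat \<Rightarrow> 's list set" where
  "reduced_words S N = {u. set u \<subseteq> S \<and> distinct_adj u \<and> length u \<le> N}"

text \<open>The generator \<open>s\<close> acts on the ball of radius \<open>N\<close> of the Cayley tree of the free product of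
  groups of order 2 indexed by \<open>S\<close>, fixing the words whose image would lie outside the ball.\<close>

definition letter_act :: "'s set \<Rightarrow> nat \<Rightarrow> 's \<Rightarrow> 's list \<Rightarrow> 's list" where
  "letter_act S N s u =
     (if u \<notin> reduced_words S N then u
      else if u \<noteq> [] \<and> hd u = s then tl u
      else if length u < N then s # u else u)"

lemma finite_reduced_words: "finite S \<Longrightarrow> finite (reduced_words S N)"
  by (rule finite_subset[OF _ finite_lists_length_le[of S N]]) (auto simp: reduced_words_def)

lemma letter_act_Cons:
  assumes "u \<in> reduced_words S N" "s \<in> S" "length u < N" "u = [] \<or> hd u \<noteq> s"
  shows "letter_act S N s u = s # u" "s # u \<in> reduced_words S N"
  using assms by (auto simp: letter_act_def reduced_words_def distinct_adj_Cons)

lemma letter_act_involution: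
  assumes "s \<in> S"
  shows "letter_act S N s (letter_act S N s u) = u"
proof (cases "u \<in> reduced_words S N")
  case u: True
  show ?thesis
  proof (cases "u \<noteq> [] \<and> hd u = s")
    case True
    then obtain u' where "u = s # u'" by (cases u) auto
    then have "u' \<in> reduced_words S N" "length u' < N" "u' = [] \<or> hd u' \<noteq> s"
      using u by (auto simp: reduced_words_def distinct_adj_Cons)
    then show ?thesis using letter_act_Cons(1)[OF _ assms] u \<open>u = s # u'\<close> by (simp add: letter_act_def)
  next
    case False
    then show ?thesis using letter_act_Cons[OF u assms] u
      by (cases "length u < N") (auto simp: letter_act_def)
  qed
qed (simp add: letter_act_def)

lemma letter_act_permutes:
  assumes "s \<in> S"
  shows "letter_act S N s permutes reduced_words S N"
  unfolding permutes_def using letter_act_involution[OF assms, of N]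
  by (metis letter_act_def)

text \<open>Two points \<open>(v, h)\<close> and \<open>(w, h')\<close> share block number \<open>i\<close> iff \<open>h'\<close> arises from \<open>h\<close> by applying
  the generators \<open>(v, i)\<close> and \<open>(w, i)\<close>. Along a reduced walk these letters never cancel, so the image
  of the empty word gets longer by two letters in each step.\<close>

lemma ex_block_system:
  fixes V :: "'v set"
  assumes "finite V" "V \<noteq> {}"
  obtains P :: "('v \<times> (('v \<times> nat) list \<Rightarrow> ('v \<times> nat) list)) set" and \<tau>
      and b :: "nat \<Rightarrow> _ \<Rightarrow> ('v \<times> nat) list \<Rightarrow> ('v \<times> nat) list"
    where "P \<noteq> {}" "block_system t V P \<tau> b" "block_system.girth_ge t P b g"
proof -
  define S where "S = V \<times> {..<t}"
  \<comment> \<open>Each block traversed costs two letters, so radius \<open>2 * g\<close> suffices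
    for walks through at most \<open>g\<close> blocks.\<close>
  define X where "X = reduced_words S (2 * g)"
  define x where "x v i = letter_act S (2 * g) (v, i)" for v i
  define P where "P = V \<times> {h. h permutes X}"
  \<comment> \<open>A block is named by the group element at its vertex of the lift, reached from
    \<open>(v, h)\<close> by the voltage \<open>x v i\<close>.\<close>
  define b where "b i = (\<lambda>(v, h :: ('v \<times> nat) list \<Rightarrow> ('v \<times> nat) list). x v i \<circ> h)" for i
  have x_idem: "x v i (x v i u) = u" if "v \<in> V" "i < t" for v i u
    using that by (simp add: x_def letter_act_involution S_def)
  have x_perm: "x v i permutes X" if "v \<in> V" "i < t" for v i
    using that by (simp add: x_def X_def letter_act_permutes S_def)
  have b_eq: "h' = x v' i \<circ> x v i \<circ> h" if "b i (v, h) = b i (v', h')" "v' \<in> V" "i < t" for i v h v' h'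
  proof
    fix u
    have "x v i (h u) = x v' i (h' u)" using that(1) by (simp add: b_def fun_eq_iff)
    then show "h' u = (x v' i \<circ> x v i \<circ> h) u" using x_idem that by simp
  qed
  interpret block_system t V P fst b
  proof
    have "finite X" using assms by (simp add: X_def S_def finite_reduced_words)
    then show "finite P" using assms by (simp add: P_def finite_permutations)
    show "fst p \<in> V" if "p \<in> P" for p using that by (auto simp: P_def)
    show "\<exists>p'\<in>P. b i p' = b i p \<and> fst p' = w" if ip: "i < t" "p \<in> P" "w \<in> V" for i p w
    proof -
      obtain v h where p: "p = (v, h)" "v \<in> V" "h permutes X" using ip by (auto simp: P_def)
      have "(w, x w i \<circ> x v i \<circ> h) \<in> P"
        using that p by (auto simp: P_def intro!: permutes_compose x_perm)
      moreover have "b i (w, x w i \<circ> x v i \<circ> h) = b i p"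
        using that x_idem by (auto simp: b_def p fun_eq_iff)
      ultimately show ?thesis by (metis fst_conv)
    qed
    show "p = p'" if pp: "i < t" "p \<in> P" "p' \<in> P" "b i p = b i p'" "fst p = fst p'" for i p p'
    proof -
      obtain v h h' where p: "p = (v, h)" "p' = (v, h')" "v \<in> V"
        using pp by (cases p, cases p') (auto simp: P_def)
      have "h' = h" using b_eq[of i v h v h'] that p x_idem by (auto simp: fun_eq_iff)
      then show ?thesis using p by simp
    qed
  qed
  \<comment> \<open>The leading letter \<open>(fst q, i)\<close> shows why nothing cancels: the next
    letter \<open>(v, j)\<close> has a different index, and the one after it,
    \<open>(v', j)\<close>, a different type.\<close>
  have walk: "snd q y \<in> X \<and> length (snd q y) = 2 * m \<and> (m > 0 \<longrightarrow> hd (snd q y) = (fst q, i))"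
    if "reduced_walk p m i q" "m \<le> g" "snd p y = []" for p q m i y
    using that
  proof (induction rule: reduced_walk.induct)
    case (start p i)
    then show ?case by (simp add: X_def reduced_words_def)
  next
    case (step p m i q j q')
    define u where "u = snd q y"
    have u: "u \<in> X" "length u = 2 * m" "m > 0 \<Longrightarrow> hd u = (fst q, i)"
      using step.IH step.prems by (auto simp: u_def)
    obtain v h v' h' where q: "q = (v, h)" "q' = (v', h')" by (cases q, cases q') auto
    have qP: "q \<in> P" using step(1) reduced_walk_in by blast
    have v: "v \<in> V" "v' \<in> V" using qP step q by (auto simp: P_def)
    have "v \<noteq> v'" using block_type_inj[of j q q'] qP step q by auto
    have "h' y = x v' j (x v j u)" using b_eq[of j v h v' h'] step q v by (simp add: u_def)
    moreover have vu: "x v j u = (v, j) # u" "(v, j) # u \<in> X"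
      using letter_act_Cons[of u S "2 * g" "(v, j)"] u step q v
      by (cases m; force simp: x_def X_def S_def)+
    moreover have "x v' j ((v, j) # u) = (v', j) # (v, j) # u" "(v', j) # (v, j) # u \<in> X"
      using letter_act_Cons[of "(v, j) # u" S "2 * g" "(v', j)"] vu(2) u step v \<open>v \<noteq> v'\<close>
      by (auto simp: x_def X_def S_def)
    ultimately show ?case using u q by simp
  qed
  have "girth_ge g" unfolding girth_ge_def
  proof (intro allI impI)
    fix p m i assume w: "reduced_walk p m i p" "m < g"
    have "snd p permutes X" using reduced_walk_in[OF w(1)] by (auto simp: P_def)
    then obtain y where y: "snd p y = []" by (metis permutes_surj surjD)
    then show "m = 0" using walk[OF w(1) _ y] w(2) by simp
  qed
  moreover have "P \<noteq> {}" using assms permutes_id[of X] unfolding P_def by blast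
  ultimately show thesis using block_system_axioms by (intro that)
qed

section \<open>Assembling the graphs of order \<open>q * n\<close>\<close>

theorem theorem21:
  fixes t k g c :: nat
    and F :: "'a pair_pre_digraph"
    and L :: "'b pair_pre_digraph"
  assumes "t \<ge> 2" and "k \<ge> 2" and "g \<ge> max 4 (k + 1)"
    and "pair_graph F" and "pair_graph L"
    and "Digraph_Component.connected (with_proj F)"
    and "card (pverts F) = k"
    and "has_constant_link F L"
    and "circumference F = c"
  shows "\<exists>n::nat. \<forall>q::nat. q \<ge> 1 \<longrightarrow>
    (\<exists>G :: nat pair_pre_digraph.
       pair_graph G \<and>
       Digraph_Component.connected (with_proj G) \<and>
       has_constant_link G (copies t L) \<and>
       card (pverts G) = q * n \<and>
       (\<forall>l. c < l \<and> l < g \<longrightarrow> \<not> has_cycle_of_length G l))"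
proof -
  define V where "V = pverts F"
  have V: "finite V" "2 \<le> card V"
    using assms(2,4,7) pair_fin_digraph.pair_finite_verts[of F]
    by (auto simp: V_def pair_graph_def pair_digraph_def)
  then have "V \<noteq> {}" by auto
  obtain P0 :: "('a \<times> (('a \<times> nat) list \<Rightarrow> ('a \<times> nat) list)) set" and \<tau>
      and b :: "nat \<Rightarrow> _ \<Rightarrow> ('a \<times> nat) list \<Rightarrow> ('a \<times> nat) list"
    where "P0 \<noteq> {}" "block_system t V P0 \<tau> b" "block_system.girth_ge t P0 b g"
    using ex_block_system[OF V(1) \<open>V \<noteq> {}\<close>, of t g] .
  from block_system.ex_connected_subsystem[OF this(2,1,3)]
  obtain P where P: "P \<noteq> {}" "block_system t V P \<tau> b" "block_system.girth_ge t P b g"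
    "block_system.block_connected t P b" by blast
  interpret P: block_system t V P \<tau> b by (rule P)
  obtain p0 where p0: "p0 \<in> P" using P by auto
  \<comment> \<open>Because \<open>k \<ge> 2\<close> there is a second type, hence a second point on
    the block of index 0 through \<open>p0\<close>, as the connectedness of the cover
    requires.\<close>
  have "card (V - {\<tau> p0}) > 0" using V P.type_in[OF p0] by (simp add: card_Diff_singleton)
  then obtain w where w: "w \<in> V" "w \<noteq> \<tau> p0" by (metis Diff_iff card_gt_0_iff ex_in_conv singletonI)
  have "\<exists>G :: nat pair_pre_digraph. pair_graph G \<and> Digraph_Component.connected (with_proj G) \<and>
       has_constant_link G (copies t L) \<and> card (pverts G) = q * card P \<and>
       (\<forall>l. c < l \<and> l < g \<longrightarrow> \<not> has_cycle_of_length G l)" if q: "1 \<le> q" for q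
  proof -
    let ?Q = "{0..<card (P \<times> {..<q})}"
    obtain f where f: "bij_betw f ?Q (P \<times> {..<q})"
      using ex_bij_betw_nat_finite[of "P \<times> {..<q}"] P.finite_points by auto
    note Q = transport_block_system[OF f P.block_system_twist[OF q]
        P.girth_ge_twist[OF q P(3)] P.block_connected_twist[OF q P(4) assms(1) p0 w]]
    interpret Q: block_system t V ?Q "\<tau> \<circ> fst \<circ> f" "\<lambda>i. P.twist p0 q i \<circ> f" using Q by blast
    have girth: "Q.girth_ge g" and conn: "Q.block_connected" using Q by auto
    have g: "4 \<le> g" using assms(3) by simp
    have "l \<le> c" if "has_cycle_of_length F l" for l
      using that finite_cycle_lengths[OF assms(4)] assms(9) by (auto simp: circumference_def)
    then have "\<not> has_cycle_of_length (Q.amalgam (parcs F)) l" if "c < l" "l < g" for l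
      using Q.amalgam_cycle_length[OF assms(4) V_def[symmetric] girth that(2)] that(1) by force
    moreover have "card (pverts (Q.amalgam (parcs F))) = q * card P"
      unfolding Q.pverts_amalgam by (simp add: card_cartesian_product)
    ultimately show ?thesis
      using Q.pair_graph_amalgam[OF assms(4)]
        Q.connected_amalgam[OF assms(4) V_def[symmetric] assms(6) conn]
        Q.has_constant_link_amalgam[OF assms(4) V_def[symmetric] assms(5,8) girth g]
      by blast
  qed
  then show ?thesis by blast
qed

end
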